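(* Let $r,s\in\mathbb{C}^*$ be roots of unity with $r^2\neq s^2$, and let $\mu=(\mu_1,\mu_2,\mu_3)\in(\mathbb{C}^* )^2\times\mathbb{C}$. Then $\mathcal{M}_2(\mu)$ is a simple $\mathcal{B}$-module of dimension $\ell_2m_2$.
   Context: $\mathcal{B}$ is the $\mathbb{C}$-algebra generated by $X_1,X_2,X_3,\tilde W$ with defining relations $$\tilde WX_1=r^{-2}X_1\tilde W,\quad X_2X_1=s^{-2}X_1X_2,\quad X_3X_1=(rs)^{-2}X_1X_3,\quad X_3X_2=(rs)^{-1}X_2X_3,$$ $$\tilde WX_3=rsX_3\tilde W,\quad \tilde WX_2=X_2\tilde W+s^2(r^2-s^2)X_3X_1.$$ (It is a subalgebra of the two-parameter quantized algebra $U^+_{r,s}(B_2)$.) All modules are right modules; $\operatorname{ord}(z)$ is the multiplicative order of $z$. Put $\ell_2=\operatorname{ord}(r^2s^2)$, and $m_2=\operatorname{ord}(rs^{-1})$ if $\operatorname{ord}(r^2)\mid\operatorname{ord}(r^2s^2)\operatorname{ord}(rs^{-1})$ or $\mu_3=0$, $m_2=2\operatorname{ord}(rs^{-1})$ otherwise. $\mathcal{M}_2(\mu)$ is the vector space with basis $\{e(a,b):0\le a\le\ell_2-1,\ 0\le b\le m_2-1\}$ and action ($\oplus$ is addition modulo $\ell_2$) $$e(a,b)X_1=r^{-2b}\mu_1e(a\oplus1,b),\qquad e(a,b)X_2=\begin{cases}(rs)^{2a}s^2(r^2-s^2)\frac{1-(r^{-1}s)^b}{1-r^{-1}s}\mu_2e(a,b-1),&b\neq0,\\0,&b=0,\end{cases}$$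 $$e(a,b)X_3=(rs)^{2a+b}\mu_1^{-1}\mu_2e(a\oplus(-1),b),\qquad e(a,b)\tilde W=\begin{cases}e(a,b+1),&b\neq m_2-1,\\ r^{2am_2}\mu_3e(a,0),&b=m_2-1.\end{cases}$$ *)

theory Defs
  imports Complex_Main "HOL-Library.Poly_Mapping" "HOL-Algebra.QuotRing"
begin

section \<open>Roots of unity\<close>

definition is_root_of_unity :: "complex \<Rightarrow> bool" where
  "is_root_of_unity z \<longleftrightarrow> (\<exists>n>0. z ^ n = 1)"

text \<open>As usual, the order is 0 for elements that are not roots of unity.\<close>

definition mult_ord :: "complex \<Rightarrow> nat" where
  "mult_ord z = (if is_root_of_unity z then LEAST n. 0 < n \<and> z ^ n = 1 else 0)"


section \<open>Complex algebras and their right modules\<close>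

text \<open>
  A unital \<open>\<complex>\<close>-algebra is a ring \<open>A\<close> together with a unital ring homomorphism \<open>\<iota>\<close>
  from \<open>\<complex>\<close> into the centre of \<open>A\<close>.
\<close>

locale complex_algebra = ring A for A :: "('a, 'k) ring_scheme" (structure) +
  fixes \<iota> :: "complex \<Rightarrow> 'a"
  assumes scalar_closed: "\<iota> c \<in> carrier A"
    and scalar_one: "\<iota> 1 = \<one>"
    and scalar_add: "\<iota> (c + d) = \<iota> c \<oplus> \<iota> d"
    and scalar_mult: "\<iota> (c * d) = \<iota> c \<otimes> \<iota> d"
    and scalar_central: "x \<in> carrier A \<Longrightarrow> \<iota> c \<otimes> x = x \<otimes> \<iota> c"

text \<open>
  The underlying space is a subspace \<open>V\<close> of an ambient complex vector space; \<open>act v x\<close> is the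
  product \<open>v x\<close>. Homogeneity of the action follows from \<open>act_scalar\<close>, \<open>act_mult\<close> and
  the centrality of scalars.
\<close>

locale right_module = complex_algebra A \<iota> + vector_space scale
  for A :: "('a, 'k) ring_scheme" (structure)
    and \<iota> :: "complex \<Rightarrow> 'a"
    and scale :: "complex \<Rightarrow> 'v::ab_group_add \<Rightarrow> 'v" +
  fixes V :: "'v set" and act :: "'v \<Rightarrow> 'a \<Rightarrow> 'v"
  assumes subspace_V: "subspace V"
    and act_closed: "\<lbrakk>v \<in> V; x \<in> carrier A\<rbrakk> \<Longrightarrow> act v x \<in> V"
    and act_add_left: "\<lbrakk>v \<in> V; w \<in> V; x \<in> carrier A\<rbrakk> \<Longrightarrow> act (v + w) x = act v x + act w x"
    and act_add_right:
      "\<lbrakk>v \<in> V; x \<in> carrier A; y \<in> carrier A\<rbrakk> \<Longrightarrow> act v (x \<oplus> y) = act v x + act v y"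
    and act_mult:
      "\<lbrakk>v \<in> V; x \<in> carrier A; y \<in> carrier A\<rbrakk> \<Longrightarrow> act v (x \<otimes> y) = act (act v x) y"
    and act_scalar: "v \<in> V \<Longrightarrow> act v (\<iota> c) = scale c v"
begin

definition submodule :: "'v set \<Rightarrow> bool" where
  "submodule U \<longleftrightarrow> subspace U \<and> U \<subseteq> V \<and> (\<forall>u\<in>U. \<forall>x\<in>carrier A. act u x \<in> U)"

end

locale simple_right_module = right_module +
  assumes nonzero: "V \<noteq> {0}"
    and simple: "submodule U \<Longrightarrow> U = {0} \<or> U = V"


section \<open>The algebra \<open>\<B>\<close>\<close>

datatype gen = X1 | X2 | X3 | W

text \<open>
  The free monoid on the generators, written additively so that the convolution product of
  \<^theory>\<open>HOL-Library.Poly_Mapping\<close> turns finitely supported functions on it into the free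
  algebra.
\<close>

datatype gen_word = Word (letters: "gen list")

instantiation gen_word :: monoid_add
begin

definition zero_gen_word :: gen_word where
  "zero_gen_word = Word []"

definition plus_gen_word :: "gen_word \<Rightarrow> gen_word \<Rightarrow> gen_word" where
  "plus_gen_word u v = Word (letters u @ letters v)"

instance
  by standard (simp_all add: zero_gen_word_def plus_gen_word_def)

end

type_synonym free_alg = "gen_word \<Rightarrow>\<^sub>0 complex"

definition free_ring :: "free_alg ring" where
  "free_ring = \<lparr>carrier = UNIV, monoid.mult = (*), one = 1, zero = 0, add = (+)\<rparr>"

definition free_gen :: "gen \<Rightarrow> free_alg" where
  "free_gen g = Poly_Mapping.single (Word [g]) 1"

definition free_scalar :: "complex \<Rightarrow> free_alg" where
  "free_scalar c = Poly_Mapping.single 0 c"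

definition B_relators :: "complex \<Rightarrow> complex \<Rightarrow> free_alg set" where
  "B_relators r s =
    (let x1 = free_gen X1; x2 = free_gen X2; x3 = free_gen X3; w = free_gen W in
     {w * x1 - free_scalar (inverse (r\<^sup>2)) * x1 * w,
      x2 * x1 - free_scalar (inverse (s\<^sup>2)) * x1 * x2,
      x3 * x1 - free_scalar (inverse ((r * s)\<^sup>2)) * x1 * x3,
      x3 * x2 - free_scalar (inverse (r * s)) * x2 * x3,
      w * x3 - free_scalar (r * s) * x3 * w,
      w * x2 - (x2 * w + free_scalar (s\<^sup>2 * (r\<^sup>2 - s\<^sup>2)) * x3 * x1)})"

definition B_ideal :: "complex \<Rightarrow> complex \<Rightarrow> free_alg set" where
  "B_ideal r s = Idl\<^bsub>free_ring\<^esub> (B_relators r s)"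

definition B_alg :: "complex \<Rightarrow> complex \<Rightarrow> free_alg set ring" where
  "B_alg r s = free_ring Quot B_ideal r s"

definition B_class :: "complex \<Rightarrow> complex \<Rightarrow> free_alg \<Rightarrow> free_alg set" where
  "B_class r s x = B_ideal r s +>\<^bsub>free_ring\<^esub> x"

definition B_gen :: "complex \<Rightarrow> complex \<Rightarrow> gen \<Rightarrow> free_alg set" where
  "B_gen r s g = B_class r s (free_gen g)"

definition B_scalar :: "complex \<Rightarrow> complex \<Rightarrow> complex \<Rightarrow> free_alg set" where
  "B_scalar r s c = B_class r s (free_scalar c)"

lemma ring_free_ring: "ring free_ring"
proof -
  have "\<exists>y::free_alg. y + x = 0" for x
    by (rule exI[of _ "- x"]) simp
  then show ?thesis
    by (intro ringI abelian_groupI monoidI) (auto simp: free_ring_def algebra_simps)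
qed

lemma ideal_B_ideal: "ideal (B_ideal r s) free_ring"
  unfolding B_ideal_def by (rule ring.genideal_ideal[OF ring_free_ring]) (simp add: free_ring_def)

lemma B_class_hom: "B_class r s \<in> ring_hom free_ring (B_alg r s)"
  using ideal.rcos_ring_hom[OF ideal_B_ideal] by (simp add: B_class_def[abs_def] B_alg_def)

lemma free_scalar_commute: "free_scalar c * x = x * free_scalar c"
proof (induction x rule: update_induct)
  case const
  then show ?case by simp
next
  case (update f k v)
  have "Poly_Mapping.update k v f = f + Poly_Mapping.single k v"
    using update(1) by (intro poly_mapping_eqI)
      (auto simp: lookup_update lookup_add lookup_single when_def in_keys_iff)
  then show ?case
    using update(3) by (simp add: algebra_simps free_scalar_def mult_single)
qed

lemma complex_algebra_B_alg: "complex_algebra (B_alg r s) (B_scalar r s)"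
proof -
  note hom = B_class_hom[of r s]
  have car: "carrier free_ring = UNIV"
    by (simp add: free_ring_def)
  have surj: "\<exists>y. x = B_class r s y" if "x \<in> carrier (B_alg r s)" for x
    using that by (auto simp: B_alg_def FactRing_def A_RCOSETS_def' B_class_def)
  have one: "free_scalar 1 = \<one>\<^bsub>free_ring\<^esub>"
    by (simp add: free_scalar_def free_ring_def)
  have add: "free_scalar (c + d) = free_scalar c \<oplus>\<^bsub>free_ring\<^esub> free_scalar d" for c d
    by (simp add: free_scalar_def free_ring_def single_add)
  have mult: "free_scalar (c * d) = free_scalar c \<otimes>\<^bsub>free_ring\<^esub> free_scalar d" for c d
    by (simp add: free_scalar_def free_ring_def mult_single)
  have comm: "free_scalar c \<otimes>\<^bsub>free_ring\<^esub> x = x \<otimes>\<^bsub>free_ring\<^esub> free_scalar c" for c x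
    by (simp add: free_ring_def free_scalar_commute)
  show ?thesis
  proof (intro complex_algebra.intro complex_algebra_axioms.intro)
    show "ring (B_alg r s)"
      unfolding B_alg_def by (rule ideal.quotient_is_ring[OF ideal_B_ideal])
  next
    fix c d and x assume x: "x \<in> carrier (B_alg r s)"
    obtain y where y: "x = B_class r s y" using surj[OF x] by blast
    show "B_scalar r s c \<otimes>\<^bsub>B_alg r s\<^esub> x = x \<otimes>\<^bsub>B_alg r s\<^esub> B_scalar r s c"
      by (simp add: y B_scalar_def ring_hom_mult[OF hom, symmetric] car comm)
  qed (simp_all add: B_scalar_def one add mult car ring_hom_one[OF hom] ring_hom_closed[OF hom]
         ring_hom_add[OF hom] ring_hom_mult[OF hom])
qed


section \<open>The module \<open>\<M>\<^sub>2(\<mu>)\<close>\<close>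

definition ell2 :: "complex \<Rightarrow> complex \<Rightarrow> nat" where
  "ell2 r s = mult_ord (r\<^sup>2 * s\<^sup>2)"

definition m2 :: "complex \<Rightarrow> complex \<Rightarrow> complex \<Rightarrow> nat" where
  "m2 r s \<mu>3 =
    (if mult_ord (r\<^sup>2) dvd mult_ord (r\<^sup>2 * s\<^sup>2) * mult_ord (r * inverse s) \<or> \<mu>3 = 0
     then mult_ord (r * inverse s)
     else 2 * mult_ord (r * inverse s))"

type_synonym vec = "nat \<times> nat \<Rightarrow>\<^sub>0 complex"

definition cscale :: "complex \<Rightarrow> vec \<Rightarrow> vec" where
  "cscale c v = Poly_Mapping.map ((*) c) v"

lemma lookup_cscale: "Poly_Mapping.lookup (cscale c v) k = c * Poly_Mapping.lookup v k"
  by (simp add: cscale_def Poly_Mapping.map.rep_eq when_def)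

global_interpretation V: vector_space cscale
  by unfold_locales (auto intro!: poly_mapping_eqI simp: lookup_cscale lookup_add algebra_simps)

definition e :: "nat \<Rightarrow> nat \<Rightarrow> vec" where
  "e a b = Poly_Mapping.single (a, b) 1"

definition M2_space :: "complex \<Rightarrow> complex \<Rightarrow> complex \<Rightarrow> vec set" where
  "M2_space r s \<mu>3 = V.span {e a b | a b. a < ell2 r s \<and> b < m2 r s \<mu>3}"

text \<open>\<open>M2_basis_act r s \<mu>1 \<mu>2 \<mu>3 g a b\<close> is the vector \<open>e(a,b) g\<close>.\<close>

fun M2_basis_act ::
    "complex \<Rightarrow> complex \<Rightarrow> complex \<Rightarrow> complex \<Rightarrow> complex \<Rightarrow> gen \<Rightarrow> nat \<Rightarrow> nat \<Rightarrow> vec" where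
  "M2_basis_act r s \<mu>1 \<mu>2 \<mu>3 X1 a b =
     cscale (inverse r ^ (2 * b) * \<mu>1) (e ((a + 1) mod ell2 r s) b)"
| "M2_basis_act r s \<mu>1 \<mu>2 \<mu>3 X2 a b =
     (if b \<noteq> 0
      then cscale ((r * s) ^ (2 * a) * s\<^sup>2 * (r\<^sup>2 - s\<^sup>2)
                   * ((1 - (inverse r * s) ^ b) / (1 - inverse r * s)) * \<mu>2) (e a (b - 1))
      else 0)"
| "M2_basis_act r s \<mu>1 \<mu>2 \<mu>3 X3 a b =
     cscale ((r * s) ^ (2 * a + b) * inverse \<mu>1 * \<mu>2) (e ((a + (ell2 r s - 1)) mod ell2 r s) b)"
| "M2_basis_act r s \<mu>1 \<mu>2 \<mu>3 W a b =
     (if b \<noteq> m2 r s \<mu>3 - 1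
      then e a (b + 1)
      else cscale (r ^ (2 * a * m2 r s \<mu>3) * \<mu>3) (e a 0))"

definition M2_gen_act ::
    "complex \<Rightarrow> complex \<Rightarrow> complex \<Rightarrow> complex \<Rightarrow> complex \<Rightarrow> vec \<Rightarrow> gen \<Rightarrow> vec" where
  "M2_gen_act r s \<mu>1 \<mu>2 \<mu>3 v g =
     (\<Sum>(a, b)\<in>Poly_Mapping.keys v.
        cscale (Poly_Mapping.lookup v (a, b)) (M2_basis_act r s \<mu>1 \<mu>2 \<mu>3 g a b))"

text \<open>A right action: the first letter of a word acts first.\<close>

definition M2_free_act ::
    "complex \<Rightarrow> complex \<Rightarrow> complex \<Rightarrow> complex \<Rightarrow> complex \<Rightarrow> vec \<Rightarrow> free_alg \<Rightarrow> vec" where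
  "M2_free_act r s \<mu>1 \<mu>2 \<mu>3 v x =
     (\<Sum>u\<in>Poly_Mapping.keys x.
        cscale (Poly_Mapping.lookup x u) (foldl (M2_gen_act r s \<mu>1 \<mu>2 \<mu>3) v (letters u)))"

text \<open>
  The action of a coset, meaningful if all its representatives act on \<open>v\<close> in the same way.
\<close>

definition M2_act ::
    "complex \<Rightarrow> complex \<Rightarrow> complex \<Rightarrow> complex \<Rightarrow> complex \<Rightarrow> vec \<Rightarrow> free_alg set \<Rightarrow> vec" where
  "M2_act r s \<mu>1 \<mu>2 \<mu>3 v x = the_elem (M2_free_act r s \<mu>1 \<mu>2 \<mu>3 v ` x)"

end

theory Submission
  imports Defs
begin

text \<open>
  The defining relations hold on the basis vectors, where the reduction of the indices is
  compensated by \<open>(rs)^(2\<l>) = 1\<close>, by \<open>(r\<inverse>s)^\<m> = 1\<close> and, unless \<open>\<mu>3 = 0\<close>, by \<open>r^(2\<m>\<l>) = 1\<close>,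
  where \<open>\<l>\<close> and \<open>\<m>\<close> are the index bounds \<open>\<ell>\<^sub>2\<close> and \<open>m\<^sub>2\<close>. So the ideal of relations annihilates the
  space. The elements \<open>X3 X1\<close>, \<open>X2 W\<close> and \<open>X1^\<l>\<close> act diagonally with eigenvalues that separate the
  basis vectors; hence a nonzero submodule contains some \<open>e a b\<close>. From there \<open>X1\<close> shifts \<open>a\<close>
  cyclically and \<open>W\<close> raises \<open>b\<close>, returning to \<open>b = 0\<close> if \<open>\<mu>3 \<noteq> 0\<close>; if \<open>\<mu>3 = 0\<close>, one descends to
  \<open>b = 0\<close> with \<open>X2\<close>.
\<close>

section \<open>Roots of unity\<close>

lemma is_root_of_unity_nonzero: "is_root_of_unity z \<Longrightarrow> z \<noteq> 0"
  by (auto simp: is_root_of_unity_def power_0_left)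

lemma is_root_of_unity_mult:
  assumes "is_root_of_unity y" "is_root_of_unity z"
  shows "is_root_of_unity (y * z)"
proof -
  obtain i j where ij: "0 < i" "y ^ i = 1" "0 < j" "z ^ j = 1"
    using assms by (auto simp: is_root_of_unity_def)
  have "(y * z) ^ (i * j) = (y ^ i) ^ j * (z ^ j) ^ i"
    by (simp add: power_mult_distrib mult.commute flip: power_mult)
  then have "(y * z) ^ (i * j) = 1"
    using ij by simp
  then show ?thesis
    using ij unfolding is_root_of_unity_def by (intro exI[of _ "i * j"]) simp
qed

lemma is_root_of_unity_inverse: "is_root_of_unity z \<Longrightarrow> is_root_of_unity (inverse z)"
  by (simp add: is_root_of_unity_def power_inverse)

lemma mult_ord_pos:
  assumes "is_root_of_unity z"
  shows "0 < mult_ord z" and "z ^ mult_ord z = 1"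
proof -
  have "\<exists>n. 0 < n \<and> z ^ n = 1"
    using assms by (auto simp: is_root_of_unity_def)
  from LeastI_ex[OF this] show "0 < mult_ord z" "z ^ mult_ord z = 1"
    using assms by (auto simp: mult_ord_def)
qed

lemma power_eq_1_iff_mult_ord_dvd:
  assumes "is_root_of_unity z"
  shows "z ^ k = 1 \<longleftrightarrow> mult_ord z dvd k"
proof
  note pos = mult_ord_pos[OF assms]
  assume k: "z ^ k = 1"
  have "z ^ k = z ^ (mult_ord z * (k div mult_ord z) + k mod mult_ord z)"
    by (simp only: mult_div_mod_eq)
  also have "\<dots> = z ^ (k mod mult_ord z)"
    unfolding power_add power_mult pos(2) by simp
  finally have "z ^ (k mod mult_ord z) = 1"
    unfolding k by (rule sym)
  moreover have less: "k mod mult_ord z < (LEAST n. 0 < n \<and> z ^ n = 1)"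
    using mod_less_divisor[OF pos(1), of k] assms unfolding mult_ord_def by (simp only: if_True)
  ultimately have "k mod mult_ord z = 0"
    using not_less_Least[OF less] by (metis gr0I)
  then show "mult_ord z dvd k"
    by (simp only: mod_eq_0_iff_dvd)
next
  assume "mult_ord z dvd k"
  then show "z ^ k = 1"
    using mult_ord_pos[OF assms] by (auto simp: power_mult)
qed

text \<open>A root of unity is nonzero, so the common factor z^i cancels. The assumption i \<le> j
  keeps the natural subtraction exact.\<close>

lemma power_eq_imp_mult_ord_dvd_diff:
  assumes "is_root_of_unity z" "z ^ i = z ^ j" "i \<le> j"
  shows "mult_ord z dvd j - i"
proof -
  have "z ^ i * z ^ (j - i) = z ^ i"
    using assms(2,3) by (metis le_add_diff_inverse power_add)
  then have "z ^ (j - i) = 1"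
    using is_root_of_unity_nonzero[OF assms(1)] by simp
  then show ?thesis
    using assms(1) by (simp add: power_eq_1_iff_mult_ord_dvd)
qed

lemma power_eq_imp_eq_below_mult_ord:
  assumes "is_root_of_unity z" "z ^ i = z ^ j" "i < mult_ord z" "j < mult_ord z"
  shows "i = j"
proof (cases "i \<le> j")
  case True
  then show ?thesis
    using power_eq_imp_mult_ord_dvd_diff[OF assms(1,2)] assms(4) by (auto dest: dvd_imp_le)
next
  case False
  then show ?thesis
    using power_eq_imp_mult_ord_dvd_diff[OF assms(1) assms(2)[symmetric]] assms(3)
    by (auto dest: dvd_imp_le)
qed


section \<open>Linear extension\<close>

text \<open>Reduces identities that are additive in a finitely supported function to single
  monomials.\<close>

lemma poly_mapping_additive_induct [case_names zero single add]:
  assumes zero: "P 0" and single: "\<And>k c. P (Poly_Mapping.single k c)"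
    and add: "\<And>f g. P f \<Longrightarrow> P g \<Longrightarrow> P (f + g)"
  shows "P (f :: 'a \<Rightarrow>\<^sub>0 'b::monoid_add)"
proof (induction f rule: update_induct)
  case const
  then show ?case by (rule zero)
next
  case (update f k v)
  have "Poly_Mapping.update k v f = f + Poly_Mapping.single k v"
    using update(1) by (intro poly_mapping_eqI)
      (auto simp: lookup_update lookup_add lookup_single when_def in_keys_iff)
  then show ?case
    using add[OF update(3) single] by simp
qed

text \<open>Generic in the index type: with index pairs it gives \<open>M2_gen_act\<close>, with
  words it gives \<open>M2_free_act\<close>, so linearity is proved once for both.\<close>

definition lin_ext :: "('k \<Rightarrow> vec) \<Rightarrow> ('k \<Rightarrow>\<^sub>0 complex) \<Rightarrow> vec" where
  "lin_ext F v = (\<Sum>k\<in>Poly_Mapping.keys v. cscale (Poly_Mapping.lookup v k) (F k))"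

lemma lin_ext_superset:
  assumes "finite K" "Poly_Mapping.keys v \<subseteq> K"
  shows "lin_ext F v = (\<Sum>k\<in>K. cscale (Poly_Mapping.lookup v k) (F k))"
  unfolding lin_ext_def using assms by (intro sum.mono_neutral_left) (auto simp: in_keys_iff)

lemma lin_ext_add: "lin_ext F (v + w) = lin_ext F v + lin_ext F w"
proof -
  let ?K = "Poly_Mapping.keys v \<union> Poly_Mapping.keys w"
  have "Poly_Mapping.keys (v + w) \<subseteq> ?K"
    by (rule Poly_Mapping.keys_add)
  then show ?thesis
    by (simp add: lin_ext_superset[of ?K] lookup_add V.scale_left_distrib sum.distrib)
qed

lemma lin_ext_zero [simp]: "lin_ext F 0 = 0"
  by (simp add: lin_ext_def)

lemma lin_ext_single [simp]: "lin_ext F (Poly_Mapping.single k c) = cscale c (F k)"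
  by (subst lin_ext_superset[of "{k}"]) auto

lemma lin_ext_minus: "lin_ext F (v - w) = lin_ext F v - lin_ext F w"
  using lin_ext_add[of F "v - w" w] by simp

lemma cscale_single: "cscale c (Poly_Mapping.single k d) = Poly_Mapping.single k (c * d)"
  by (rule poly_mapping_eqI) (simp add: lookup_cscale lookup_single when_def)

lemma lin_ext_cscale: "lin_ext F (cscale c v) = cscale c (lin_ext F v)"
  by (induction v rule: poly_mapping_additive_induct)
    (simp_all add: cscale_single V.scale_right_distrib lin_ext_add)

lemma linear_eq_lin_ext:
  assumes "T 0 = 0" and add: "\<And>v w. T (v + w) = T v + T w"
    and scale: "\<And>c v. T (cscale c v) = cscale c (T v)"
  shows "T v = lin_ext (\<lambda>(a, b). T (e a b)) v"
proof (induction v rule: poly_mapping_additive_induct)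
  case (single k c)
  have "Poly_Mapping.single k c = cscale c (e (fst k) (snd k))"
    by (simp add: e_def cscale_single)
  then have "T (Poly_Mapping.single k c) = cscale c (T (e (fst k) (snd k)))"
    by (simp add: scale)
  then show ?case
    by (simp add: split_beta)
qed (use assms in \<open>simp_all add: lin_ext_add\<close>)


lemma lin_ext_fun_add: "lin_ext (\<lambda>k. F k + G k) v = lin_ext F v + lin_ext G v"
  by (simp add: lin_ext_def V.scale_right_distrib sum.distrib)

lemma lin_ext_fun_cscale: "lin_ext (\<lambda>k. cscale c (F k)) v = cscale c (lin_ext F v)"
  by (simp add: lin_ext_def V.scale_sum_right mult.commute)

text \<open>
  Take a nonzero vector of minimal support. If two basis vectors occurred in it, the difference of
  its images under \<open>T i\<close> and under the scalar \<open>\<theta> i k\<close> would have a smaller support.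
\<close>

lemma separating_diagonal_maps_imp_basis_vector:
  assumes U: "V.subspace U" "U \<noteq> {0}" and sup: "\<And>u. u \<in> U \<Longrightarrow> Poly_Mapping.keys u \<subseteq> K"
    and closed: "\<And>i u. u \<in> U \<Longrightarrow> T i u \<in> U"
    and diag: "\<And>i u k. u \<in> U \<Longrightarrow>
      Poly_Mapping.lookup (T i u) k = \<theta> i k * Poly_Mapping.lookup u k"
    and sep: "\<And>k k'. k \<in> K \<Longrightarrow> k' \<in> K \<Longrightarrow> (\<And>i. \<theta> i k = \<theta> i k') \<Longrightarrow> k = k'"
  obtains k where "k \<in> K" "Poly_Mapping.single k 1 \<in> U"
proof -
  obtain u0 where "u0 \<in> U" "u0 \<noteq> 0"
    using U V.subspace_0 by blast
  then obtain u where u: "u \<in> U" "u \<noteq> 0"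
    and min: "\<And>v. v \<in> U \<Longrightarrow> v \<noteq> 0 \<Longrightarrow> card (Poly_Mapping.keys u) \<le> card (Poly_Mapping.keys v)"
    using ex_has_least_nat[of "\<lambda>u. u \<in> U \<and> u \<noteq> 0" u0 "\<lambda>u. card (Poly_Mapping.keys u)"] by blast
  obtain k where k: "k \<in> Poly_Mapping.keys u"
    using u(2) by (metis ex_in_conv keys_eq_empty)
  have "k' = k" if k': "k' \<in> Poly_Mapping.keys u" for k'
  proof (rule sep)
    fix i
    define v where "v = T i u - cscale (\<theta> i k) u"
    have v: "Poly_Mapping.lookup v j = (\<theta> i j - \<theta> i k) * Poly_Mapping.lookup u j" for j
      by (simp add: v_def lookup_minus lookup_cscale diag[OF u(1)] algebra_simps)
    then have "Poly_Mapping.keys v \<subseteq> Poly_Mapping.keys u - {k}"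
      by (auto simp: in_keys_iff)
    then have "card (Poly_Mapping.keys v) < card (Poly_Mapping.keys u)"
      using k by (intro psubset_card_mono) auto
    moreover have "v \<in> U"
      unfolding v_def using U u closed by (intro V.subspace_diff V.subspace_scale) auto
    ultimately have "v = 0"
      using min by fastforce
    then show "\<theta> i k' = \<theta> i k"
      using v[of k'] k' by (simp add: in_keys_iff)
  qed (use sup[OF u(1)] k k' in auto)
  then have "u = Poly_Mapping.single k (Poly_Mapping.lookup u k)"
    by (intro poly_mapping_eqI) (auto simp: lookup_single when_def in_keys_iff)
  then have "cscale (inverse (Poly_Mapping.lookup u k)) u = Poly_Mapping.single k 1"
    using k by (metis cscale_single in_keys_iff left_inverse)
  then show ?thesis
    using that[of k] sup[OF u(1)] k V.subspace_scale[OF U(1) u(1)] by (metis subsetD)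
qed


section \<open>The action of the free algebra\<close>

locale M2_module =
  fixes r s \<mu>1 \<mu>2 \<mu>3 :: complex
  assumes roots: "is_root_of_unity r" "is_root_of_unity s"
    and neq: "r\<^sup>2 \<noteq> s\<^sup>2"
    and mu: "\<mu>1 \<noteq> 0" "\<mu>2 \<noteq> 0"
begin

abbreviation "\<l> \<equiv> ell2 r s"
abbreviation "\<n> \<equiv> mult_ord (r * inverse s)"
abbreviation "\<m> \<equiv> m2 r s \<mu>3"
abbreviation "indices \<equiv> {..<\<l>} \<times> {..<\<m>}"
abbreviation "space \<equiv> M2_space r s \<mu>3"
abbreviation "basis_act \<equiv> M2_basis_act r s \<mu>1 \<mu>2 \<mu>3"
abbreviation "gen_act \<equiv> M2_gen_act r s \<mu>1 \<mu>2 \<mu>3"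
abbreviation "word_act \<equiv> foldl gen_act"
abbreviation "free_act \<equiv> M2_free_act r s \<mu>1 \<mu>2 \<mu>3"

lemma gen_act_eq_lin_ext: "gen_act v g = lin_ext (\<lambda>(a, b). basis_act g a b) v"
  by (simp add: M2_gen_act_def lin_ext_def split_beta)

lemma gen_act_e [simp]: "gen_act (e a b) g = basis_act g a b"
  by (simp add: gen_act_eq_lin_ext e_def)

lemma gen_act_add: "gen_act (v + w) g = gen_act v g + gen_act w g"
  by (simp add: gen_act_eq_lin_ext lin_ext_add)

lemma gen_act_cscale: "gen_act (cscale c v) g = cscale c (gen_act v g)"
  by (simp add: gen_act_eq_lin_ext lin_ext_cscale)

lemma gen_act_zero [simp]: "gen_act 0 g = 0"
  by (simp add: gen_act_eq_lin_ext)

lemma word_act_add: "word_act (v + w) us = word_act v us + word_act w us"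
  by (induction us arbitrary: v w) (simp_all add: gen_act_add)

lemma word_act_cscale: "word_act (cscale c v) us = cscale c (word_act v us)"
  by (induction us arbitrary: v) (simp_all add: gen_act_cscale)

lemma word_act_zero [simp]: "word_act 0 us = 0"
  by (induction us) simp_all

lemma free_act_eq_lin_ext: "free_act v x = lin_ext (\<lambda>u. word_act v (letters u)) x"
  by (simp add: M2_free_act_def lin_ext_def)

lemma free_act_add: "free_act v (x + y) = free_act v x + free_act v y"
  by (simp add: free_act_eq_lin_ext lin_ext_add)

lemma free_act_minus: "free_act v (x - y) = free_act v x - free_act v y"
  by (simp add: free_act_eq_lin_ext lin_ext_minus)

lemma free_act_zero [simp]: "free_act v 0 = 0"
  by (simp add: free_act_eq_lin_ext)

lemma free_act_add_left: "free_act (v + w) x = free_act v x + free_act w x"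
  by (simp add: free_act_eq_lin_ext word_act_add lin_ext_fun_add)

lemma free_act_cscale: "free_act (cscale c v) x = cscale c (free_act v x)"
  by (simp add: free_act_eq_lin_ext word_act_cscale lin_ext_fun_cscale)

lemma free_act_zero_left [simp]: "free_act 0 x = 0"
  using free_act_cscale[of 0 0 x] by simp

lemma free_act_single: "free_act v (Poly_Mapping.single u c) = cscale c (word_act v (letters u))"
  by (simp add: free_act_eq_lin_ext)

lemma free_act_gen [simp]: "free_act v (free_gen g) = gen_act v g"
  by (simp add: free_gen_def free_act_single)

lemma free_act_scalar [simp]: "free_act v (free_scalar c) = cscale c v"
  by (simp add: free_scalar_def free_act_single zero_gen_word_def)

text \<open>On monomials the product concatenates words, and \<open>foldl\<close> over a
  concatenation runs through the left word first. Additivity in both factors does the rest.\<close>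

lemma free_act_mult: "free_act v (x * y) = free_act (free_act v x) y"
proof (induction y rule: poly_mapping_additive_induct)
  case (single k c)
  show ?case
  proof (induction x rule: poly_mapping_additive_induct)
    case (single j d)
    then show ?case
      by (simp add: mult_single free_act_single plus_gen_word_def word_act_cscale mult.commute)
  qed (simp_all add: distrib_right free_act_add free_act_add_left)
qed (simp_all add: distrib_left free_act_add)


section \<open>The underlying vector space\<close>

text \<open>Gives the span the support form in which the minimal support argument can be
  applied.\<close>

lemma mem_space_iff: "v \<in> space \<longleftrightarrow> Poly_Mapping.keys v \<subseteq> indices"
proof
  have "V.subspace {v. Poly_Mapping.keys v \<subseteq> indices}"
  proof (rule V.subspaceI)
    fix x y :: vec assume "x \<in> {v. Poly_Mapping.keys v \<subseteq> indices}" "y \<in> {v. Poly_Mapping.keys v \<subseteq> indices}"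
    then show "x + y \<in> {v. Poly_Mapping.keys v \<subseteq> indices}"
      using Poly_Mapping.keys_add[of x y] by blast
  next
    fix c and x :: vec assume "x \<in> {v. Poly_Mapping.keys v \<subseteq> indices}"
    moreover have "Poly_Mapping.keys (cscale c x) \<subseteq> Poly_Mapping.keys x"
      by (auto simp: in_keys_iff lookup_cscale)
    ultimately show "cscale c x \<in> {v. Poly_Mapping.keys v \<subseteq> indices}"
      by blast
  qed simp
  then have "space \<subseteq> {v. Poly_Mapping.keys v \<subseteq> indices}"
    unfolding M2_space_def by (intro V.span_minimal) (auto simp: e_def)
  then show "v \<in> space \<Longrightarrow> Poly_Mapping.keys v \<subseteq> indices"
    by blast
next
  assume *: "Poly_Mapping.keys v \<subseteq> indices"
  have "v = (\<Sum>k\<in>Poly_Mapping.keys v. cscale (Poly_Mapping.lookup v k) (e (fst k) (snd k)))"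
    using linear_eq_lin_ext[of "\<lambda>v. v" v] by (simp add: lin_ext_def split_beta)
  also have "\<dots> \<in> space"
    unfolding M2_space_def
  proof (intro V.span_sum V.span_scale V.span_base CollectI exI conjI)
    fix k assume "k \<in> Poly_Mapping.keys v"
    then show "fst k < \<l>" "snd k < \<m>"
      using * by auto
  qed simp
  finally show "v \<in> space" .
qed

lemma e_in_space_iff: "e a b \<in> space \<longleftrightarrow> (a, b) \<in> indices"
  by (auto simp: mem_space_iff e_def)

lemma subspace_space: "V.subspace space"
  by (simp add: M2_space_def)

lemma dim_space: "V.dim space = \<l> * \<m>"
proof -
  let ?f = "\<lambda>k. e (fst k) (snd k)"
  have inj: "inj_on ?f indices"
    by (rule inj_onI) (metis e_def keys_single one_neq_zero prod.collapse singleton_inject)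
  have eq: "{e a b |a b. a < \<l> \<and> b < \<m>} = ?f ` indices"
    by force
  have "V.independent (?f ` indices)"
  proof (rule V.independent_if_scalars_zero)
    fix h x assume sum0: "(\<Sum>x\<in>?f ` indices. cscale (h x) x) = 0" and "x \<in> ?f ` indices"
    then obtain k where k: "k \<in> indices" "x = ?f k" by blast
    \<comment> \<open>Evaluating the vanishing combination at the index k isolates the coefficient
      of x.\<close>
    have "0 = Poly_Mapping.lookup (\<Sum>j\<in>indices. cscale (h (?f j)) (?f j)) k"
      using sum0 by (simp add: sum.reindex[OF inj])
    also have "\<dots> = (\<Sum>j\<in>indices. if j = k then h (?f j) else 0)"
      by (simp add: lookup_sum lookup_cscale e_def lookup_single when_def if_distrib cong: if_cong)
    also have "\<dots> = h x"
      using k by simp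
    finally show "h x = 0" by simp
  qed simp
  then have "V.dim space = card (?f ` indices)"
    unfolding M2_space_def eq by (rule V.dim_span_eq_card_independent)
  then show ?thesis
    by (simp add: card_image[OF inj])
qed


section \<open>The defining relations\<close>

lemma nonzero: "r \<noteq> 0" "s \<noteq> 0"
  using roots by (auto dest: is_root_of_unity_nonzero)

lemma power_l: "0 < \<l>" "(r * s) ^ (2 * \<l>) = 1"
proof -
  have "is_root_of_unity (r\<^sup>2 * s\<^sup>2)"
    using roots by (simp add: power2_eq_square is_root_of_unity_mult)
  from mult_ord_pos[OF this] show "0 < \<l>" "(r * s) ^ (2 * \<l>) = 1"
    by (simp_all add: ell2_def power_mult power_mult_distrib)
qed

lemma power_l_mod: "(r * s) ^ (2 * (a mod \<l>)) = (r * s) ^ (2 * a)"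
proof -
  have "(r * s) ^ (2 * a) = (r * s) ^ (2 * \<l> * (a div \<l>) + 2 * (a mod \<l>))"
    by (metis distrib_left mult.assoc mult_div_mod_eq)
  then show ?thesis
    by (simp add: power_add power_mult[of _ "2 * \<l>"] power_l(2))
qed

lemma root_r_div_s: "is_root_of_unity (r * inverse s)"
  using roots by (simp add: is_root_of_unity_mult is_root_of_unity_inverse)

lemma power_n: "0 < \<n>" "(inverse r * s) ^ \<n> = 1"
proof -
  note * = mult_ord_pos[OF root_r_div_s]
  have "inverse r * s = inverse (r * inverse s)"
    by simp
  then show "0 < \<n>" "(inverse r * s) ^ \<n> = 1"
    using * by (simp_all only: power_inverse inverse_1)
qed

lemma root_s_div_r: "is_root_of_unity (inverse r * s)"
  using power_n by (auto simp: is_root_of_unity_def)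

text \<open>The action involves powers of s/r while \<open>m2\<close> is built from r/s. Mutually
  inverse elements are killed by the same exponents.\<close>

lemma mult_ord_s_div_r: "mult_ord (inverse r * s) = \<n>"
proof -
  have "inverse r * s = inverse (r * inverse s)"
    by simp
  then have "(inverse r * s) ^ k = 1 \<longleftrightarrow> (r * inverse s) ^ k = 1" for k
    by (simp only: power_inverse inverse_eq_1_iff)
  then show ?thesis
    using root_s_div_r root_r_div_s power_eq_1_iff_mult_ord_dvd
    by (metis dvd_antisym dvd_refl)
qed

lemma s_div_r_neq_1: "inverse r * s \<noteq> 1"
  using neq nonzero by (auto simp: field_simps)

text \<open>The divisibility in \<open>m2\<close> says that r^(2 \<open>\<n>\<close>
  \<open>\<l>\<close>) = 1, which makes the factor r^(2 a \<open>\<n>\<close>) depend only on a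
  modulo \<open>\<l>\<close>. If this fails and \<open>\<mu>3\<close> is nonzero, the period in b
  has to be doubled; the failure is recorded because simplicity relies on it.\<close>

lemma m_cases:
  obtains "\<m> = \<n>" "r ^ (2 * \<m> * \<l>) = 1 \<or> \<mu>3 = 0"
  | "\<m> = 2 * \<n>" "\<mu>3 \<noteq> 0" "r ^ (2 * \<n> * \<l>) \<noteq> 1" "r ^ (2 * \<m> * \<l>) = 1"
proof -
  have "is_root_of_unity (r\<^sup>2)"
    using roots by (simp add: power2_eq_square is_root_of_unity_mult)
  then have dvd_iff: "mult_ord (r\<^sup>2) dvd \<l> * \<n> \<longleftrightarrow> r ^ (2 * \<n> * \<l>) = 1"
    using power_eq_1_iff_mult_ord_dvd[of "r\<^sup>2" "\<l> * \<n>"]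
    by (simp add: mult.commute mult.left_commute flip: power_mult)
  show ?thesis
  proof (cases "r ^ (2 * \<n> * \<l>) = 1 \<or> \<mu>3 = 0")
    case True
    then have "\<m> = \<n>"
      using dvd_iff by (simp add: m2_def flip: ell2_def)
    then show ?thesis
      using True that(1) by simp
  next
    case False
    then have m: "\<m> = 2 * \<n>"
      using dvd_iff by (simp add: m2_def flip: ell2_def)
    \<comment> \<open>Doubling is enough since r^2 = (r s)(r/s), and both factors have trivial power
      2 \<open>\<l>\<close> \<open>\<n>\<close>.\<close>
    have "r ^ (2 * \<m> * \<l>) = ((r * s) ^ (2 * \<l>)) ^ \<n> * ((r * inverse s) ^ \<n>) ^ (2 * \<l>)"
      using nonzero unfolding m
      by (simp add: power_mult_distrib power_inverse mult_ac flip: power_mult power_add)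
    also have "\<dots> = 1"
      using power_l mult_ord_pos[OF root_r_div_s] by simp
    finally show ?thesis
      using m False that(2) by blast
  qed
qed

lemma power_m: "0 < \<m>" "(inverse r * s) ^ \<m> = 1" "r ^ (2 * \<m> * \<l>) = 1 \<or> \<mu>3 = 0"
  by (cases rule: m_cases; simp add: power_n mult.commute[of 2] power_mult[of _ \<n> 2])+

text \<open>Keeping the factor \<open>\<mu>3\<close> on both sides covers \<open>\<mu>3\<close> = 0,
  where r^(2 \<open>\<m>\<close> \<open>\<l>\<close>) may differ from 1.\<close>

lemma power_m_mod: "r ^ (2 * (a mod \<l>) * \<m>) * \<mu>3 = r ^ (2 * a * \<m>) * \<mu>3"
proof (cases "\<mu>3 = 0")
  case False
  have "2 * a * \<m> = 2 * \<m> * \<l> * (a div \<l>) + 2 * (a mod \<l>) * \<m>"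
    by (metis (no_types, lifting) distrib_left mult.assoc mult.commute mult_div_mod_eq)
  then have "r ^ (2 * a * \<m>) = (r ^ (2 * \<m> * \<l>)) ^ (a div \<l>) * r ^ (2 * (a mod \<l>) * \<m>)"
    by (simp only: power_add power_mult)
  then show ?thesis
    using power_m(3) False by simp
qed simp

section \<open>Index shifts, coefficients, and the six relations on basis vectors\<close>

lemma shift_inverse:
  assumes "a < \<l>"
  shows "((a + 1) mod \<l> + (\<l> - 1)) mod \<l> = a" "((a + (\<l> - 1)) mod \<l> + 1) mod \<l> = a"
  using assms unfolding mod_add_left_eq by simp_all

lemma gen_act_X3_X1:
  assumes "a < \<l>"
  shows "gen_act (gen_act (e a b) X3) X1 = cscale ((r * s) ^ (2 * a) * (inverse r * s) ^ b * \<mu>2) (e a b)"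
proof -
  have "(r * s) ^ b * inverse r ^ (2 * b) = (inverse r * s) ^ b"
    using nonzero by (simp add: power_mult power2_eq_square field_simps flip: power_mult_distrib)
  moreover have "(r * s) ^ (2 * a + b) * inverse \<mu>1 * \<mu>2 * (inverse r ^ (2 * b) * \<mu>1)
      = (r * s) ^ (2 * a) * ((r * s) ^ b * inverse r ^ (2 * b)) * \<mu>2"
    using mu by (simp add: power_add field_simps)
  ultimately have "(r * s) ^ (2 * a + b) * inverse \<mu>1 * \<mu>2 * (inverse r ^ (2 * b) * \<mu>1)
      = (r * s) ^ (2 * a) * (inverse r * s) ^ b * \<mu>2"
    by simp
  then show ?thesis
    using shift_inverse(2)[OF assms] by (simp add: gen_act_cscale)
qed

text \<open>The formula vanishes at b = 0, so \<open>basis_act_X2\<close> holds without a case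
  distinction and the truncated b - 1 does no harm.\<close>

definition X2_coeff :: "nat \<Rightarrow> nat \<Rightarrow> complex" where
  "X2_coeff a b = (r * s) ^ (2 * a) * s\<^sup>2 * (r\<^sup>2 - s\<^sup>2)
     * ((1 - (inverse r * s) ^ b) / (1 - inverse r * s)) * \<mu>2"

lemma X2_coeff_eq_0_iff: "X2_coeff a b = 0 \<longleftrightarrow> \<n> dvd b"
  using nonzero neq mu s_div_r_neq_1 power_eq_1_iff_mult_ord_dvd[OF root_s_div_r, of b]
  by (auto simp: X2_coeff_def mult_ord_s_div_r)

lemma basis_act_X2: "basis_act X2 a b = cscale (X2_coeff a b) (e a (b - 1))"
  by (simp add: X2_coeff_def)

text \<open>With p = s/r the quotient is the geometric sum 1 + ... + p^(b-1), which grows by p^b.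
  The increment is a multiple of the eigenvalue of X3 X1, as the relation between W and X2
  demands.\<close>

lemma X2_coeff_Suc:
  "X2_coeff a (Suc b)
   = X2_coeff a b + s\<^sup>2 * (r\<^sup>2 - s\<^sup>2) * ((r * s) ^ (2 * a) * (inverse r * s) ^ b * \<mu>2)"
proof -
  have *: "(1 - p ^ Suc b) / (1 - p) = (1 - p ^ b) / (1 - p) + p ^ b" if "p \<noteq> 1" for p :: complex
    using that by (simp add: field_simps)
  show ?thesis
    unfolding X2_coeff_def *[OF s_div_r_neq_1] by (simp only: algebra_simps)
qed

text \<open>X2 lowers b first, so W raises it back without wrapping around; at b = 0 both sides
  vanish.\<close>

lemma gen_act_X2_W:
  assumes "b < \<m>"
  shows "gen_act (gen_act (e a b) X2) W = cscale (X2_coeff a b) (e a b)"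
proof (cases b)
  case 0
  then show ?thesis by (simp add: X2_coeff_def)
next
  case (Suc c)
  then have "c \<noteq> \<m> - 1"
    using assms by simp
  then show ?thesis
    by (simp add: basis_act_X2 gen_act_cscale Suc del: M2_basis_act.simps(2))
qed

lemma relation_W_X1:
  assumes "a < \<l>" "b < \<m>"
  shows "gen_act (gen_act (e a b) W) X1 = cscale (inverse (r\<^sup>2)) (gen_act (gen_act (e a b) X1) W)"
proof (cases "b = \<m> - 1")
  case False
  then show ?thesis
    by (simp add: gen_act_cscale power2_eq_square power_inverse mult_ac)
next
  case True
  \<comment> \<open>At the wrap, the scalar of the relation completes r^(-2b) to r^(-2
    \<open>\<m>\<close>). This cancels the factor r^(2 \<open>\<m>\<close>) that W gains when X1 has
    raised a.\<close>
  then have "\<m> = Suc b"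
    using power_m(1) by simp
  then have "inverse (r\<^sup>2) * inverse r ^ (2 * b) = inverse (r ^ (2 * \<m>))"
    by (simp add: power_inverse power2_eq_square)
  moreover have "r ^ (2 * ((a + 1) mod \<l>) * \<m>) * \<mu>3 = r ^ (2 * a * \<m>) * r ^ (2 * \<m>) * \<mu>3"
    unfolding power_m_mod by (simp add: algebra_simps power_add)
  ultimately have "inverse (r\<^sup>2) * (inverse r ^ (2 * b) * \<mu>1 * (r ^ (2 * ((a + 1) mod \<l>) * \<m>) * \<mu>3))
      = r ^ (2 * a * \<m>) * \<mu>3 * \<mu>1"
    using nonzero by (simp add: field_simps)
  from this[symmetric] show ?thesis
    using True by (simp add: gen_act_cscale mult.assoc)
qed

lemma relation_X2_X1:
  "gen_act (gen_act (e a b) X2) X1 = cscale (inverse (s\<^sup>2)) (gen_act (gen_act (e a b) X1) X2)"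
proof (cases b)
  case (Suc c)
  \<comment> \<open>Raising a costs (r s)^2; after division by s^2 the remaining r^2 turns r^(-2b)
    into r^(-2(b-1)).\<close>
  have "X2_coeff ((a + 1) mod \<l>) b = (r * s)\<^sup>2 * X2_coeff a b"
    unfolding X2_coeff_def power_l_mod by (simp add: power2_eq_square)
  then have "inverse (s\<^sup>2) * (inverse r ^ (2 * b) * \<mu>1 * X2_coeff ((a + 1) mod \<l>) b)
      = X2_coeff a b * (inverse r ^ (2 * c) * \<mu>1)"
    using nonzero Suc by (simp add: power2_eq_square field_simps)
  from this[symmetric] show ?thesis
    using Suc by (simp add: basis_act_X2 gen_act_cscale del: M2_basis_act.simps(2))
qed (simp add: gen_act_cscale)

lemma relation_X3_X1:
  assumes "a < \<l>"
  shows "gen_act (gen_act (e a b) X3) X1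
    = cscale (inverse ((r * s)\<^sup>2)) (gen_act (gen_act (e a b) X1) X3)"
proof -
  have "(r * s) ^ (2 * ((a + 1) mod \<l>) + b) = (r * s)\<^sup>2 * (r * s) ^ (2 * a + b)"
    unfolding power_add power_l_mod by (simp add: power2_eq_square)
  then have "inverse ((r * s)\<^sup>2) * (inverse r ^ (2 * b) * \<mu>1
        * ((r * s) ^ (2 * ((a + 1) mod \<l>) + b) * inverse \<mu>1 * \<mu>2))
      = (r * s) ^ (2 * a + b) * inverse \<mu>1 * \<mu>2 * (inverse r ^ (2 * b) * \<mu>1)"
    using nonzero by simp
  from this[symmetric] show ?thesis
    using shift_inverse[OF assms] by (simp add: gen_act_cscale)
qed

lemma power_l_mod_pred: "(r * s) ^ (2 * ((a + (\<l> - 1)) mod \<l>)) * (r * s)\<^sup>2 = (r * s) ^ (2 * a)"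
proof -
  have "2 * (a + (\<l> - 1)) + 2 = 2 * a + 2 * \<l>"
    using power_l(1) by simp
  then have "(r * s) ^ (2 * (a + (\<l> - 1))) * (r * s)\<^sup>2 = (r * s) ^ (2 * a + 2 * \<l>)"
    by (simp only: flip: power_add)
  then show ?thesis
    unfolding power_l_mod by (simp only: power_add power_l(2) mult_1_right)
qed

lemma relation_X3_X2:
  "gen_act (gen_act (e a b) X3) X2 = cscale (inverse (r * s)) (gen_act (gen_act (e a b) X2) X3)"
proof (cases b)
  case (Suc c)
  have *: "X2_coeff a b = X2_coeff ((a + (\<l> - 1)) mod \<l>) b * (r * s)\<^sup>2"
    unfolding X2_coeff_def power_l_mod_pred[of a, symmetric] by (simp only: mult_ac)
  have "inverse (r * s) * (X2_coeff a b * ((r * s) ^ (2 * a + c) * inverse \<mu>1 * \<mu>2))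
      = (r * s) ^ (2 * a + b) * inverse \<mu>1 * \<mu>2 * X2_coeff ((a + (\<l> - 1)) mod \<l>) b"
    unfolding * using nonzero Suc by (simp add: power2_eq_square field_simps)
  from this[symmetric] show ?thesis
    using Suc by (simp add: basis_act_X2 gen_act_cscale del: M2_basis_act.simps(2))
qed (simp add: gen_act_cscale)

lemma relation_W_X3:
  assumes "b < \<m>"
  shows "gen_act (gen_act (e a b) W) X3 = cscale (r * s) (gen_act (gen_act (e a b) X3) W)"
proof (cases "b = \<m> - 1")
  case False
  then show ?thesis
    by (simp add: gen_act_cscale mult_ac)
next
  case True
  \<comment> \<open>At the wrap, lowering a divides the factor of W by r^(2 \<open>\<m>\<close>).
    The powers of r s supply (r s)^\<open>\<m>\<close>, which equals r^(2 \<open>\<m>\<close>)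
    because (s/r)^\<open>\<m>\<close> = 1.\<close>
  let ?a = "(a + (\<l> - 1)) mod \<l>"
  have "2 * (a + (\<l> - 1)) * \<m> + 2 * \<m> = 2 * a * \<m> + 2 * \<m> * \<l>"
    using power_l(1) by (cases \<l>) (simp_all add: algebra_simps)
  then have "r ^ (2 * (a + (\<l> - 1)) * \<m>) * r ^ (2 * \<m>) = r ^ (2 * a * \<m>) * r ^ (2 * \<m> * \<l>)"
    by (simp only: flip: power_add)
  moreover have "r ^ (2 * ?a * \<m>) * \<mu>3 * r ^ (2 * \<m>)
      = r ^ (2 * (a + (\<l> - 1)) * \<m>) * r ^ (2 * \<m>) * \<mu>3"
    unfolding power_m_mod by (simp only: mult_ac)
  ultimately have "r ^ (2 * ?a * \<m>) * \<mu>3 * r ^ (2 * \<m>) = r ^ (2 * a * \<m>) * \<mu>3"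
    using power_m(3) by auto
  moreover have "r * s * (r * s) ^ b = r ^ (2 * \<m>)"
  proof -
    have "r * s * (r * s) ^ b = (r * s) ^ \<m>"
      using True power_m(1) by (simp flip: power_Suc)
    also have "\<dots> = (r\<^sup>2 * (inverse r * s)) ^ \<m>"
      using nonzero by (simp add: power2_eq_square field_simps)
    also have "\<dots> = r ^ (2 * \<m>) * (inverse r * s) ^ \<m>"
      by (simp only: power_mult_distrib power_mult)
    finally show ?thesis
      by (simp add: power_m)
  qed
  moreover have "r * s * ((r * s) ^ (2 * a + b) * inverse \<mu>1 * \<mu>2 * (r ^ (2 * ?a * \<m>) * \<mu>3))
      = r ^ (2 * ?a * \<m>) * \<mu>3 * (r * s * (r * s) ^ b) * ((r * s) ^ (2 * a) * inverse \<mu>1 * \<mu>2)"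
    by (simp only: power_add mult_ac)
  ultimately have "r * s * ((r * s) ^ (2 * a + b) * inverse \<mu>1 * \<mu>2 * (r ^ (2 * ?a * \<m>) * \<mu>3))
      = r ^ (2 * a * \<m>) * \<mu>3 * ((r * s) ^ (2 * a) * inverse \<mu>1 * \<mu>2)"
    by (simp only:)
  from this[symmetric] show ?thesis
    using True by (simp add: gen_act_cscale)
qed

lemma relation_W_X2:
  assumes "a < \<l>" "b < \<m>"
  shows "gen_act (gen_act (e a b) W) X2 = gen_act (gen_act (e a b) X2) W
    + cscale (s\<^sup>2 * (r\<^sup>2 - s\<^sup>2)) (gen_act (gen_act (e a b) X3) X1)"
proof -
  have "gen_act (gen_act (e a b) W) X2 = cscale (X2_coeff a (Suc b)) (e a b)"
  proof (cases "b = \<m> - 1")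
    case True
    \<comment> \<open>W wraps to a multiple of \<open>e a 0\<close>, which X2 kills. The coefficient
      at b = \<open>\<m>\<close> agrees with this, since (s/r)^\<open>\<m>\<close> = 1.\<close>
    then have "X2_coeff a (Suc b) = 0"
      using power_m by (simp add: X2_coeff_def)
    then show ?thesis
      using True by (simp add: gen_act_cscale)
  qed (simp add: X2_coeff_def)
  then show ?thesis
    using assms
    by (simp only: gen_act_X2_W gen_act_X3_X1 X2_coeff_Suc V.scale_left_distrib V.scale_scale)
qed

section \<open>Descent of the action to the quotient algebra\<close>

lemma gen_act_closed:
  assumes "v \<in> space"
  shows "gen_act v g \<in> space"
proof -
  have "basis_act g a b \<in> space" if "(a, b) \<in> indices" for a b
    using that by (cases g) (auto intro!: V.subspace_scale subspace_space V.subspace_0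
      simp: e_in_space_iff power_m)
  then show ?thesis
    using assms unfolding gen_act_eq_lin_ext lin_ext_def mem_space_iff[of v]
    by (intro V.subspace_sum V.subspace_scale subspace_space) auto
qed

lemma free_act_closed:
  assumes "v \<in> space"
  shows "free_act v x \<in> space"
proof -
  have "word_act v us \<in> space" for us
    using assms by (induction us arbitrary: v) (simp_all add: gen_act_closed)
  then show ?thesis
    unfolding free_act_eq_lin_ext lin_ext_def
    by (intro V.subspace_sum V.subspace_scale subspace_space)
qed

lemma free_act_relator:
  assumes "x \<in> B_relators r s" "v \<in> space"
  shows "free_act v x = 0"
proof -
  have "free_act (e a b) x = 0" if "(a, b) \<in> indices" for a b
    using assms(1) that
    by (auto simp: B_relators_def Let_def free_act_minus free_act_add free_act_mult gen_act_cscale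
        relation_W_X1 relation_X2_X1 relation_X3_X1 relation_X3_X2 relation_W_X3 relation_W_X2
        simp del: gen_act_e)
  moreover have "V.subspace {v. free_act v x = 0}"
    by (rule V.subspaceI) (simp_all add: free_act_add_left free_act_cscale)
  ultimately have "space \<subseteq> {v. free_act v x = 0}"
    unfolding M2_space_def by (intro V.span_minimal) auto
  then show ?thesis
    using assms(2) by blast
qed

text \<open>The annihilator of the whole space is a two-sided ideal: closure under left
  multiplication uses that the space is stable under the action. It contains the relators, hence the
  ideal they generate.\<close>

lemma free_act_B_ideal:
  assumes "x \<in> B_ideal r s" "v \<in> space"
  shows "free_act v x = 0"
proof -
  interpret ring free_ring by (rule ring_free_ring)
  let ?I = "{x. \<forall>v\<in>space. free_act v x = 0}"
  have "ideal ?I free_ring"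
  proof (rule idealI[OF ring_free_ring])
    show "subgroup ?I (add_monoid free_ring)"
    proof
      fix x assume x: "x \<in> ?I"
      \<comment> \<open>The additive inverse in the ring structure has to be identified with
        \<open>- x\<close> before linearity applies.\<close>
      have "- x \<oplus>\<^bsub>free_ring\<^esub> x = \<zero>\<^bsub>free_ring\<^esub>"
        by (simp add: free_ring_def)
      then have "\<ominus>\<^bsub>free_ring\<^esub> x = - x"
        by (intro minus_equality) (simp_all add: free_ring_def)
      then show "inv\<^bsub>add_monoid free_ring\<^esub> x \<in> ?I"
        using x free_act_minus[of _ 0 x] by (simp add: a_inv_def)
    qed (simp_all add: free_ring_def free_act_add)
  qed (simp_all add: free_ring_def free_act_mult free_act_closed)
  then have "B_ideal r s \<subseteq> ?I"
    unfolding B_ideal_def by (rule genideal_minimal) (simp add: free_act_relator subset_iff)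
  then show ?thesis
    using assms by blast
qed

text \<open>Representatives differ by elements of the ideal, which annihilate v. So the image of the
  coset is a singleton and \<open>the_elem\<close> is meaningful.\<close>

lemma M2_act_B_class:
  assumes "v \<in> space"
  shows "M2_act r s \<mu>1 \<mu>2 \<mu>3 v (B_class r s x) = free_act v x"
proof -
  interpret ideal "B_ideal r s" free_ring by (rule ideal_B_ideal)
  have "B_class r s x = (\<lambda>i. i + x) ` B_ideal r s"
    by (auto simp: B_class_def a_r_coset_def' free_ring_def)
  moreover have "0 \<in> B_ideal r s"
    using additive_subgroup.zero_closed[OF is_additive_subgroup] by (simp add: free_ring_def)
  ultimately have "free_act v ` B_class r s x = {free_act v x}"
    using assms by (force simp: free_act_add free_act_B_ideal image_image)
  then show ?thesis
    by (simp add: M2_act_def)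
qed

lemma right_module_M2:
  "right_module (B_alg r s) (B_scalar r s) cscale space (M2_act r s \<mu>1 \<mu>2 \<mu>3)"
proof (intro right_module.intro right_module_axioms.intro complex_algebra_B_alg V.vector_space_axioms
    subspace_space)
  have car: "carrier free_ring = UNIV"
    by (simp add: free_ring_def)
  have repr: "\<exists>y. x = B_class r s y" if "x \<in> carrier (B_alg r s)" for x
    using that by (auto simp: B_alg_def FactRing_def A_RCOSETS_def' B_class_def)
  have add: "B_class r s x \<oplus>\<^bsub>B_alg r s\<^esub> B_class r s y = B_class r s (x + y)" for x y
    using ring_hom_add[OF B_class_hom[of r s], of x y] by (simp add: free_ring_def)
  have mult: "B_class r s x \<otimes>\<^bsub>B_alg r s\<^esub> B_class r s y = B_class r s (x * y)" for x y
    using ring_hom_mult[OF B_class_hom[of r s], of x y] by (simp add: free_ring_def)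
  fix v w x y c
  assume v: "v \<in> space"
  show "M2_act r s \<mu>1 \<mu>2 \<mu>3 v (B_scalar r s c) = cscale c v"
    using v by (simp add: B_scalar_def M2_act_B_class)
  assume "x \<in> carrier (B_alg r s)"
  then obtain x' where x: "x = B_class r s x'"
    using repr by blast
  show "M2_act r s \<mu>1 \<mu>2 \<mu>3 v x \<in> space"
    using v by (simp add: x M2_act_B_class free_act_closed)
  show "M2_act r s \<mu>1 \<mu>2 \<mu>3 (v + w) x = M2_act r s \<mu>1 \<mu>2 \<mu>3 v x + M2_act r s \<mu>1 \<mu>2 \<mu>3 w x"
    if "w \<in> space"
    using v that
    by (simp add: x M2_act_B_class free_act_add_left V.subspace_add[OF subspace_space])
  assume "y \<in> carrier (B_alg r s)"
  then obtain y' where y: "y = B_class r s y'"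
    using repr by blast
  show "M2_act r s \<mu>1 \<mu>2 \<mu>3 v (x \<oplus>\<^bsub>B_alg r s\<^esub> y) = M2_act r s \<mu>1 \<mu>2 \<mu>3 v x + M2_act r s \<mu>1 \<mu>2 \<mu>3 v y"
    using v by (simp add: x y add M2_act_B_class free_act_add)
  show "M2_act r s \<mu>1 \<mu>2 \<mu>3 v (x \<otimes>\<^bsub>B_alg r s\<^esub> y) = M2_act r s \<mu>1 \<mu>2 \<mu>3 (M2_act r s \<mu>1 \<mu>2 \<mu>3 v x) y"
    using v by (simp add: x y mult M2_act_B_class free_act_mult free_act_closed)
qed

lemma M2_act_B_gen: "v \<in> space \<Longrightarrow> M2_act r s \<mu>1 \<mu>2 \<mu>3 v (B_gen r s g) = gen_act v g"
  by (simp add: B_gen_def M2_act_B_class)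


section \<open>Simplicity\<close>

lemma word_act_X1:
  assumes "a < \<l>"
  shows "word_act (e a b) (replicate k X1)
    = cscale ((inverse r ^ (2 * b) * \<mu>1) ^ k) (e ((a + k) mod \<l>) b)"
  using assms
  by (induction k)
    (simp_all add: replicate_append_same[symmetric] gen_act_cscale mod_simps mult_ac)

lemma word_act_diagonal:
  assumes "\<And>a b. (a, b) \<in> indices \<Longrightarrow> word_act (e a b) us = cscale (\<theta> (a, b)) (e a b)"
    and "v \<in> space"
  shows "Poly_Mapping.lookup (word_act v us) k = \<theta> k * Poly_Mapping.lookup v k"
proof -
  have "word_act v us = lin_ext (\<lambda>(a, b). word_act (e a b) us) v"
    by (rule linear_eq_lin_ext) (simp_all add: word_act_add word_act_cscale)
  also have "\<dots> = (\<Sum>j\<in>Poly_Mapping.keys v. cscale (Poly_Mapping.lookup v j * \<theta> j) (Poly_Mapping.single j 1))"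
    unfolding lin_ext_def
    by (rule sum.cong) (use assms in \<open>auto simp: mem_space_iff e_def\<close>)
  finally have "Poly_Mapping.lookup (word_act v us) k
      = (\<Sum>j\<in>Poly_Mapping.keys v. if j = k then Poly_Mapping.lookup v j * \<theta> j else 0)"
    by (simp add: lookup_sum lookup_cscale lookup_single when_def if_distrib cong: if_cong)
  also have "\<dots> = \<theta> k * Poly_Mapping.lookup v k"
    by (simp add: in_keys_iff)
  finally show ?thesis .
qed

text \<open>
  The eigenvalues of \<open>X3 X1\<close> and \<open>X2 W\<close> at \<open>e a b\<close> determine \<open>a\<close>, and \<open>b\<close> modulo \<open>\<n>\<close>; the power
  \<open>X1^\<l>\<close> separates \<open>b\<close> from \<open>b + \<n>\<close> when \<open>\<m> = 2\<n>\<close>, with \<open>\<n> = ord(r s\<inverse>)\<close>.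
\<close>

fun diagonal_word :: "nat \<Rightarrow> gen list" where
  "diagonal_word 0 = [X3, X1]"
| "diagonal_word (Suc 0) = [X2, W]"
| "diagonal_word _ = replicate \<l> X1"

fun eigenvalue :: "nat \<Rightarrow> nat \<times> nat \<Rightarrow> complex" where
  "eigenvalue 0 (a, b) = (r * s) ^ (2 * a) * (inverse r * s) ^ b * \<mu>2"
| "eigenvalue (Suc 0) (a, b) = X2_coeff a b"
| "eigenvalue _ (a, b) = (inverse r ^ (2 * b) * \<mu>1) ^ \<l>"

lemma word_act_diagonal_word:
  assumes "(a, b) \<in> indices"
  shows "word_act (e a b) (diagonal_word i) = cscale (eigenvalue i (a, b)) (e a b)"
  using assms
  by (cases i rule: diagonal_word.cases)
    (simp_all add: gen_act_X3_X1 gen_act_X2_W word_act_X1 del: gen_act_e)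

text \<open>The first equation makes b' - b a multiple of \<open>\<n>\<close>, and it is less than
  \<open>\<m>\<close>. If \<open>\<m>\<close> = 2 \<open>\<n>\<close>, the only nonzero possibility
  is \<open>\<n>\<close>; the second equation would then give r^(2 \<open>\<n>\<close>
  \<open>\<l>\<close>) = 1, against the choice of \<open>\<m>\<close>.\<close>

lemma power_r_l_separates:
  assumes "b < \<m>" "b' < \<m>" "b \<le> b'"
    and "(inverse r * s) ^ b = (inverse r * s) ^ b'"
    and "(inverse r ^ (2 * b)) ^ \<l> = (inverse r ^ (2 * b')) ^ \<l>"
  shows "b = b'"
proof (rule ccontr)
  assume "b \<noteq> b'"
  have dvd: "\<n> dvd b' - b"
    using power_eq_imp_mult_ord_dvd_diff[OF root_s_div_r assms(4,3)]
    by (simp only: mult_ord_s_div_r)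
  show False
  proof (cases rule: m_cases)
    case 1
    then show False
      using dvd assms \<open>b \<noteq> b'\<close> by (auto dest: dvd_imp_le)
  next
    case 2
    obtain k where k: "b' - b = \<n> * k"
      using dvd by blast
    moreover have "b' - b < \<n> * 2" "b' - b \<noteq> 0"
      using assms(2,3) 2(1) \<open>b \<noteq> b'\<close> by linarith+
    ultimately have "k < 2" "k \<noteq> 0"
      by (simp_all only: mult_less_cancel1) auto
    then have "k = 1"
      by simp
    then have b': "b' = b + \<n>"
      using k assms(3) by simp
    have "r ^ (2 * b * \<l>) = r ^ (2 * b' * \<l>)"
      using assms(5) by (simp add: power_inverse flip: power_mult)
    also have "\<dots> = r ^ (2 * b * \<l>) * r ^ (2 * \<n> * \<l>)"
      by (simp add: b' algebra_simps power_add)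
    finally show False
      using 2(3) nonzero by simp
  qed
qed

lemma eigenvalues_separate:
  assumes "k \<in> indices" "k' \<in> indices" and eq: "\<And>i. eigenvalue i k = eigenvalue i k'"
  shows "k = k'"
proof -
  obtain a b a' b' where k: "k = (a, b)" "k' = (a', b')"
    by (metis surj_pair)
  let ?q = "(r * s) ^ (2 * a)" and ?q' = "(r * s) ^ (2 * a')"
  let ?p = "(inverse r * s) ^ b" and ?p' = "(inverse r * s) ^ b'"
  have 1: "?q * ?p = ?q' * ?p'"
    using eq[of 0] mu by (simp add: k)
  have "s\<^sup>2 * (r\<^sup>2 - s\<^sup>2) * \<mu>2 / (1 - inverse r * s) * (?q * (1 - ?p))
      = s\<^sup>2 * (r\<^sup>2 - s\<^sup>2) * \<mu>2 / (1 - inverse r * s) * (?q' * (1 - ?p'))"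
    using eq[of "Suc 0"] by (simp add: k X2_coeff_def mult_ac)
  then have "?q * (1 - ?p) = ?q' * (1 - ?p')"
    using nonzero neq mu s_div_r_neq_1 by (subst (asm) mult_left_cancel) auto
  \<comment> \<open>Adding the two equations cancels the products q p and q' p'.\<close>
  with 1 have q: "?q = ?q'"
    by (simp add: right_diff_distrib)
  have "is_root_of_unity (r\<^sup>2 * s\<^sup>2)"
    using roots by (simp add: power2_eq_square is_root_of_unity_mult)
  \<comment> \<open>The squares of r s have order \<open>\<l>\<close>, and both indices lie below
    it.\<close>
  then have "a = a'"
    using q assms(1,2) by (intro power_eq_imp_eq_below_mult_ord[of "r\<^sup>2 * s\<^sup>2"])
      (simp_all add: k power_mult power_mult_distrib flip: ell2_def)
  moreover have p: "?p = ?p'"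
    using 1 q nonzero by simp
  have "(inverse r ^ (2 * b)) ^ \<l> = (inverse r ^ (2 * b')) ^ \<l>"
    using eq[of "Suc (Suc 0)"] mu by (simp add: k power_mult_distrib)
  then have "b = b'"
    using power_r_l_separates[of b b'] power_r_l_separates[of b' b] p assms(1,2)
    by (auto simp: k intro: le_cases)
  ultimately show ?thesis
    by (simp add: k)
qed

section \<open>Reaching every basis vector from one\<close>

lemma invariant_subspace_eq_space:
  assumes U: "V.subspace U" "U \<subseteq> space" "U \<noteq> {0}"
    and closed: "\<And>u g. u \<in> U \<Longrightarrow> gen_act u g \<in> U"
  shows "U = space"
proof -
  have word: "word_act u us \<in> U" if "u \<in> U" for u us
    using that by (induction us arbitrary: u) (simp_all add: closed)
  have unscale: "u \<in> U" if "cscale c u \<in> U" "c \<noteq> 0" for c u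
    using V.subspace_scale[OF U(1) that(1), of "inverse c"] that(2) by simp
  obtain k where "k \<in> indices" "Poly_Mapping.single k 1 \<in> U"
  proof (rule separating_diagonal_maps_imp_basis_vector
      [where T = "\<lambda>i u. word_act u (diagonal_word i)" and \<theta> = eigenvalue, OF U(1,3)])
    show "Poly_Mapping.lookup (word_act u (diagonal_word i)) k
        = eigenvalue i k * Poly_Mapping.lookup u k" if "u \<in> U" for i u k
      using that U(2) by (intro word_act_diagonal word_act_diagonal_word) auto
    show "Poly_Mapping.keys u \<subseteq> indices" if "u \<in> U" for u
      using that U(2) mem_space_iff by blast
    show "k = k'" if "k \<in> indices" "k' \<in> indices" "\<And>i. eigenvalue i k = eigenvalue i k'" for k k'
      using that by (rule eigenvalues_separate)
  qed (rule word)
  then obtain a b where ab: "a < \<l>" "b < \<m>" "e a b \<in> U"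
    by (auto simp: e_def)
  have shift: "e a' b \<in> U" if "a' < \<l>" for a'
  proof (rule unscale)
    \<comment> \<open>\<open>\<l> - a\<close> steps bring the first index round to 0 and a' more
      bring it to a', whichever of a and a' is larger.\<close>
    have "(a + (a' + (\<l> - a))) mod \<l> = a'"
      using that ab by simp
    then show "cscale ((inverse r ^ (2 * b) * \<mu>1) ^ (a' + (\<l> - a))) (e a' b) \<in> U"
      using word[OF ab(3), of "replicate (a' + (\<l> - a)) X1"] word_act_X1[OF ab(1)] by metis
  qed (use nonzero mu in simp)
  have lower: "e a' 0 \<in> U" if "a' < \<l>" for a'
  proof (cases "\<mu>3 = 0")
    case True
    then have "\<m> = \<n>"
      by (cases rule: m_cases) auto
    \<comment> \<open>Truncated subtraction makes the descent stop at \<open>e a' 0\<close>. Before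
      that, 0 < b - j < \<open>\<n>\<close>, so the coefficient of X2 is nonzero.\<close>
    then have "e a' (b - j) \<in> U" for j
    proof (induction j)
      case (Suc j)
      show ?case
      proof (cases "b \<le> j")
        case False
        have "X2_coeff a' (b - j) \<noteq> 0"
          unfolding X2_coeff_eq_0_iff
          using False ab(2) \<open>\<m> = \<n>\<close> by (auto dest: dvd_imp_le)
        moreover have "gen_act (e a' (b - j)) X2 = cscale (X2_coeff a' (b - j)) (e a' (b - Suc j))"
          unfolding gen_act_e basis_act_X2 by simp
        ultimately show ?thesis
          using closed[OF Suc.IH[OF Suc.prems], of X2] unscale by metis
      qed (use Suc in simp)
    qed (use shift that in simp)
    from this[of b] show ?thesis by simp
  next
    case False
    \<comment> \<open>Here W climbs to the top row, and one more W closes the cycle with a factor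
      that is nonzero because \<open>\<mu>3\<close> is.\<close>
    have "e a' (b + j) \<in> U" if "b + j < \<m>" for j
      using that
    proof (induction j)
      case (Suc j)
      then have "b + j \<noteq> \<m> - 1" "e a' (b + j) \<in> U"
        by simp_all
      then show ?case
        using closed[of "e a' (b + j)" W] by simp
    qed (use shift \<open>a' < \<l>\<close> in simp)
    from this[of "\<m> - 1 - b"] have "e a' (\<m> - 1) \<in> U"
      using ab(2) by simp
    from closed[OF this, of W] have "cscale (r ^ (2 * a' * \<m>) * \<mu>3) (e a' 0) \<in> U"
      by simp
    then show ?thesis
      by (rule unscale) (use False nonzero in simp)
  qed
  have "e a' b' \<in> U" if "a' < \<l>" "b' < \<m>" for a' b'
    using that(2)
  proof (induction b')
    case (Suc b')
    then have "b' \<noteq> \<m> - 1" "e a' b' \<in> U"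
      by simp_all
    then show ?case
      using closed[of "e a' b'" W] by simp
  qed (use lower that in simp)
  then have "space \<subseteq> U"
    unfolding M2_space_def using U(1) by (intro V.span_minimal) auto
  then show ?thesis
    using U(2) by blast
qed

lemma simple_right_module_M2:
  "simple_right_module (B_alg r s) (B_scalar r s) cscale space (M2_act r s \<mu>1 \<mu>2 \<mu>3)"
proof (rule simple_right_module.intro[OF right_module_M2 simple_right_module_axioms.intro])
  have "e 0 0 \<in> space"
    by (simp add: e_in_space_iff power_l power_m)
  moreover have "e 0 0 \<noteq> 0"
    by (metis e_def keys_single keys_zero one_neq_zero insert_not_empty)
  ultimately show "space \<noteq> {0}"
    by blast
next
  interpret right_module "B_alg r s" "B_scalar r s" cscale space "M2_act r s \<mu>1 \<mu>2 \<mu>3"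
    by (rule right_module_M2)
  fix U
  assume "submodule U"
  then have U: "V.subspace U" "U \<subseteq> space"
    and closed: "\<And>u x. u \<in> U \<Longrightarrow> x \<in> carrier (B_alg r s) \<Longrightarrow> M2_act r s \<mu>1 \<mu>2 \<mu>3 u x \<in> U"
    by (auto simp: submodule_def)
  \<comment> \<open>Closure under the generator classes is all that the argument on invariant
    subspaces needs.\<close>
  have "B_gen r s g \<in> carrier (B_alg r s)" for g
    unfolding B_gen_def by (rule ring_hom_closed[OF B_class_hom]) (simp add: free_ring_def)
  then have "gen_act u g \<in> U" if "u \<in> U" for u g
    using closed[of u "B_gen r s g"] U(2) that by (simp add: M2_act_B_gen subset_iff)
  then show "U = {0} \<or> U = space"
    using invariant_subspace_eq_space[OF U] by blast
qed

end

theorem theorem5p3: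
  fixes r s \<mu>1 \<mu>2 \<mu>3 :: complex
  assumes "r \<noteq> 0" and "s \<noteq> 0"
    and "is_root_of_unity r" and "is_root_of_unity s"
    and "r\<^sup>2 \<noteq> s\<^sup>2"
    and "\<mu>1 \<noteq> 0" and "\<mu>2 \<noteq> 0"
  shows "simple_right_module (B_alg r s) (B_scalar r s) cscale
           (M2_space r s \<mu>3) (M2_act r s \<mu>1 \<mu>2 \<mu>3)
       \<and> (\<forall>g a b. a < ell2 r s \<longrightarrow> b < m2 r s \<mu>3 \<longrightarrow>
            M2_act r s \<mu>1 \<mu>2 \<mu>3 (e a b) (B_gen r s g) = M2_basis_act r s \<mu>1 \<mu>2 \<mu>3 g a b)
       \<and> V.dim (M2_space r s \<mu>3) = ell2 r s * m2 r s \<mu>3"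
proof -
  interpret M2_module r s \<mu>1 \<mu>2 \<mu>3
    using assms by unfold_locales
  show ?thesis
    using simple_right_module_M2 dim_space by (simp add: M2_act_B_gen e_in_space_iff)
qed

end
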